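(* Let $S$ be a locally finite space satisfying Axiom 1. Then $S$ satisfies Axiom 3 (the frontier $Fr(T,S)$ of every subset $T\subset S$ is thin) if and only if the neighborhood relation $N$ of $S$ is antisymmetric.
   Context: A locally finite (LF) space is a nonempty set $S$ such that to each element $e\in S$ certain finite subsets of $S$ are assigned as neighborhoods of $e$ (at least one for each $e$). Axiom 1: each neighborhood of $e$ contains $e$, and the intersection of two neighborhoods of $e$ is again a neighborhood of $e$. Hence each $e$ has a smallest neighborhood $SN(e)$, the intersection of all its neighborhoods, which is itself a neighborhood of $e$. Frontier: for $T\subseteq S$, $Fr(T,S)$ is the set of all $e\in S$ such that each neighborhood of $e$ (equivalently $SN(e)$) contains elements of both $T$ and $S\setminus T$. Neighborhood relation: $aNb$ iff $a\in SN(b)$. Opponents: elements $a,b$ of $Fr(T,S)$ are opponents if $a\in SN(b)$, $b\in SN(a)$, one of them belongs to $T$ and the other to $S\setminus T$. The frontier $Fr(T,S)$ is thick if it contains at least one pair of opponents; otherwise it is thin. *)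

theory Defs
  imports Main
begin

text \<open>The map \<open>nbhs\<close> assigns to each element of \<open>S\<close> the collection of its neighborhoods;
  its values outside \<open>S\<close> are irrelevant.\<close>

locale lf_space =
  fixes S :: "'a set" and nbhs :: "'a \<Rightarrow> 'a set set"
  assumes space_nonempty: "S \<noteq> {}"
    and nbhs_nonempty: "e \<in> S \<Longrightarrow> nbhs e \<noteq> {}"
    and nbhs_subset: "e \<in> S \<Longrightarrow> U \<in> nbhs e \<Longrightarrow> U \<subseteq> S"
    and nbhs_finite: "e \<in> S \<Longrightarrow> U \<in> nbhs e \<Longrightarrow> finite U"

definition axiom1 :: "'a set \<Rightarrow> ('a \<Rightarrow> 'a set set) \<Rightarrow> bool" where
  "axiom1 S nbhs \<longleftrightarrow>
     (\<forall>e\<in>S. (\<forall>U\<in>nbhs e. e \<in> U) \<and> (\<forall>U\<in>nbhs e. \<forall>V\<in>nbhs e. U \<inter> V \<in> nbhs e))"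

definition SN :: "('a \<Rightarrow> 'a set set) \<Rightarrow> 'a \<Rightarrow> 'a set" where
  "SN nbhs e = \<Inter>(nbhs e)"

definition Fr :: "('a \<Rightarrow> 'a set set) \<Rightarrow> 'a set \<Rightarrow> 'a set \<Rightarrow> 'a set" where
  "Fr nbhs T S = {e \<in> S. \<forall>U\<in>nbhs e. U \<inter> T \<noteq> {} \<and> U \<inter> (S - T) \<noteq> {}}"

definition neighborhood_rel :: "'a set \<Rightarrow> ('a \<Rightarrow> 'a set set) \<Rightarrow> 'a rel" where
  "neighborhood_rel S nbhs = {(a, b). a \<in> S \<and> b \<in> S \<and> a \<in> SN nbhs b}"

definition opponents :: "('a \<Rightarrow> 'a set set) \<Rightarrow> 'a set \<Rightarrow> 'a set \<Rightarrow> 'a \<Rightarrow> 'a \<Rightarrow> bool" where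
  "opponents nbhs T S a b \<longleftrightarrow>
     a \<in> Fr nbhs T S \<and> b \<in> Fr nbhs T S \<and> a \<in> SN nbhs b \<and> b \<in> SN nbhs a \<and>
     (a \<in> T \<and> b \<in> S - T \<or> b \<in> T \<and> a \<in> S - T)"

definition thick_frontier :: "('a \<Rightarrow> 'a set set) \<Rightarrow> 'a set \<Rightarrow> 'a set \<Rightarrow> bool" where
  "thick_frontier nbhs T S \<longleftrightarrow> (\<exists>a b. opponents nbhs T S a b)"

abbreviation thin_frontier :: "('a \<Rightarrow> 'a set set) \<Rightarrow> 'a set \<Rightarrow> 'a set \<Rightarrow> bool" where
  "thin_frontier nbhs T S \<equiv> \<not> thick_frontier nbhs T S"

definition axiom3 :: "'a set \<Rightarrow> ('a \<Rightarrow> 'a set set) \<Rightarrow> bool" where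
  "axiom3 S nbhs \<longleftrightarrow> (\<forall>T. T \<subseteq> S \<longrightarrow> thin_frontier nbhs T S)"

end

theory Submission
  imports Defs
begin

text \<open>Opponents are distinct and mutually \<open>N\<close>-related; conversely, distinct mutually \<open>N\<close>-related
  elements \<open>a\<close> and \<open>b\<close> are opponents in the frontier of \<open>{a}\<close>.\<close>

lemma opponents_imp_not_antisym:
  assumes "opponents nbhs T S a b" and "T \<subseteq> S"
  shows "\<not> antisym (neighborhood_rel S nbhs)"
  using assms by (auto simp: opponents_def neighborhood_rel_def antisym_def)

lemma opponents_singleton:
  assumes "axiom1 S nbhs" and "a \<in> S" "b \<in> S" "a \<noteq> b"
    and "a \<in> SN nbhs b" "b \<in> SN nbhs a"
  shows "opponents nbhs {a} S a b"
proof -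
  \<comment> \<open>Axiom 1 puts the point whose neighborhood \<open>U\<close> is into
    \<open>U\<close>; the other point lies in the intersection \<open>SN\<close> of all these
    neighborhoods, hence also in \<open>U\<close>.\<close>
  have "a \<in> U \<and> b \<in> U" if "U \<in> nbhs a \<union> nbhs b" for U
    using that assms by (auto simp: axiom1_def SN_def)
  \<comment> \<open>Each such \<open>U\<close> meets \<open>{a}\<close> in \<open>a\<close> and
    \<open>S - {a}\<close> in \<open>b\<close>, since \<open>a \<noteq> b\<close>.\<close>
  then have "{a, b} \<subseteq> Fr nbhs {a} S"
    using assms by (fastforce simp: Fr_def)
  then show ?thesis
    using assms by (simp add: opponents_def)
qed

theorem mainTheorem2:
  fixes S :: "'a set" and nbhs :: "'a \<Rightarrow> 'a set set"
  assumes "lf_space S nbhs"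
    and "axiom1 S nbhs"
  shows "axiom3 S nbhs \<longleftrightarrow> antisym (neighborhood_rel S nbhs)"
proof
  assume thin: "axiom3 S nbhs"
  show "antisym (neighborhood_rel S nbhs)"
  proof (rule antisymI, rule ccontr)
    fix a b
    assume "(a, b) \<in> neighborhood_rel S nbhs" "(b, a) \<in> neighborhood_rel S nbhs" "a \<noteq> b"
    \<comment> \<open>Axiom 3 will be applied to the subset \<open>{a}\<close>;
      \<open>a \<in> S\<close> secures \<open>{a} \<subseteq> S\<close>.\<close>
    then have "a \<in> S" "opponents nbhs {a} S a b"
      using opponents_singleton[OF assms(2)] by (auto simp: neighborhood_rel_def)
    then show False
      using thin by (auto simp: axiom3_def thick_frontier_def)
  qed
next
  assume "antisym (neighborhood_rel S nbhs)"
  then show "axiom3 S nbhs"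
    using opponents_imp_not_antisym by (fastforce simp: axiom3_def thick_frontier_def)
qed

end
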